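(* Let $\mathbf{g}:\mathbb{R}^d\to M$ be a parametrization of a $d$-dimensional manifold $M\subset\mathbb{R}^{\tilde d}$, let $\pi$ be a probability density function on $\mathbb{R}^d$, and let $\tilde\pi$ denote the probability density function of the random variable $\mathbf{g}(\boldsymbol\Theta)$ for $\boldsymbol\Theta\sim\pi$. If $(\tilde{\boldsymbol\theta}(t),\tilde{\mathbf p}(t))$ is a solution of the Newtonian dynamics on $M$ with potential energy $\tilde U(\tilde{\boldsymbol\theta})=-\log\tilde\pi(\tilde{\boldsymbol\theta})$, then $$(\boldsymbol\theta(t),\mathbf p(t))=\left(\mathbf{g}^{-1}(\tilde{\boldsymbol\theta}(t)),\ \mathbf{D}\mathbf{g}^T_{\mathbf{g}^{-1}(\tilde{\boldsymbol\theta}(t))}\,\tilde{\mathbf p}(t)\right)$$ is a solution of Hamiltonian dynamics in $\mathbb{R}^d$, i.e. of $$\frac{d\boldsymbol\theta}{dt}=\nabla_{\mathbf p}H(\boldsymbol\theta,\mathbf p),\qquad\frac{d\mathbf p}{dt}=-\nabla_{\boldsymbol\theta}H(\boldsymbol\theta,\mathbf p),$$ corresponding to the Hamiltonian $$H(\boldsymbol\theta,\mathbf p)=-\log\pi(\boldsymbol\theta)+\log|\mathbf{G}(\boldsymbol\theta)|^{1/2}+\tfrac12\,\mathbf p^T\mathbf{G}^{-1}(\boldsymbol\theta)\,\mathbf p\qquad\text{with}\quad\mathbf{G}(\boldsymbol\theta)=\mathbf{D}\mathbf{g}_{\boldsymbol\theta}^T\,\mathbf{D}\mathbf{g}_{\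boldsymbol\theta}.$$
   Context: $T_{\tilde{\boldsymbol\theta}}M\subset\mathbb{R}^{\tilde d}$ denotes the tangent space of $M$ at $\tilde{\boldsymbol\theta}$. A parametrization $\mathbf{g}$ of $M$ is a differentiable bijection onto $M$, whose Jacobian $\mathbf{D}\mathbf{g}_{\boldsymbol\theta}$ is a full rank $\tilde d\times d$ matrix. The density of $\mathbf{g}(\boldsymbol\Theta)$ on $M$ is given by the generalized change of variable formula $\tilde\pi(\tilde{\boldsymbol\theta})=|\mathbf{D}\mathbf{g}_{\boldsymbol\theta}^T\mathbf{D}\mathbf{g}_{\boldsymbol\theta}|^{-1/2}\pi(\boldsymbol\theta)$ with $\boldsymbol\theta=\mathbf{g}^{-1}(\tilde{\boldsymbol\theta})$, where $|\cdot|$ is the determinant. Gradient on $M$: for a function $\tilde U$ on $M$, $\nabla^M\tilde U(\tilde{\boldsymbol\theta})$ is the unique vector in $T_{\tilde{\boldsymbol\theta}}M$ with $\langle\nabla^M\tilde U(\tilde{\boldsymbol\theta}),\mathbf{c}'(0)\rangle=\frac{d}{dt}\tilde U(\mathbf{c}(t))|_{t=0}$ for all differentiable curves $\mathbf{c}(t)$ on $M$ with $\mathbf{c}(0)=\tilde{\boldsymbol\theta}$. Newtonian dynamics on $M$ under the potential energy $\tilde U$ (motion of a particle constrained on $M$): the trajectory with initial condition $\tilde{\boldsymbol\theta}_0\in M$, $\tilde{\mathbf p}_0\in T_{\tilde{\boldsymbol\theta}_0}M$ is the unique solution $(\tilde{\boldsymbol\theta}(t),\tilde{\mathbf p}(t))\in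 M\times T_{\tilde{\boldsymbol\theta}(t)}M$ of $\frac{d\tilde{\boldsymbol\theta}}{dt}=\tilde{\mathbf p}$, $\frac{d\tilde{\mathbf p}}{dt}=-\nabla^M\tilde U(\tilde{\boldsymbol\theta})$ such that $\tilde{\boldsymbol\theta}(0)=\tilde{\boldsymbol\theta}_0$ and $\tilde{\mathbf p}(0)=\tilde{\mathbf p}_0$.
   Formalization: The parametrization g is assumed twice differentiable (needed for the gradient of H in θ to exist), and π is assumed positive and differentiable at the points of the trajectory. *)

theory Defs
  imports "HOL-Probability.Probability"
begin

section \<open>Submanifolds of Euclidean space\<close>

text \<open>
  \<open>M\<close> is covered by local parametrizations that are immersions and homeomorphisms onto relatively
  open subsets of \<open>M\<close>. The dimension is the number of elements of the index type \<open>'d\<close>. Only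
  continuous differentiability of the charts is required, so smooth submanifolds are included.
\<close>

definition submanifold :: "'d::finite itself \<Rightarrow> (real ^ 'n::finite) set \<Rightarrow> bool" where
  "submanifold T M \<longleftrightarrow>
    (\<forall>x\<in>M. \<exists>U V (\<phi> :: real ^ 'd \<Rightarrow> real ^ 'n) \<psi>.
      open U \<and> x \<in> U \<and> open V \<and> homeomorphism V (M \<inter> U) \<phi> \<psi> \<and>
      (\<forall>y\<in>V. \<phi> differentiable (at y) \<and> rank (jacobian \<phi> (at y)) = CARD('d)) \<and>
      continuous_on V (\<lambda>y. jacobian \<phi> (at y)))"

definition parametrization :: "(real ^ 'd::finite \<Rightarrow> real ^ 'n::finite) \<Rightarrow> (real ^ 'n) set \<Rightarrow> bool" where
  "parametrization g M \<longleftrightarrow>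
    bij_betw g UNIV M \<and>
    (\<forall>x. g differentiable (at x) \<and> rank (jacobian g (at x)) = CARD('d))"

text \<open>Curves need only be defined on \<open>M\<close> near time 0.\<close>

definition curve_on :: "'a::real_normed_vector set \<Rightarrow> (real \<Rightarrow> 'a) \<Rightarrow> 'a \<Rightarrow> bool" where
  "curve_on M c x \<longleftrightarrow>
    c 0 = x \<and> (\<exists>e>0. \<forall>t. \<bar>t\<bar> < e \<longrightarrow> c t \<in> M \<and> c differentiable (at t))"

definition tangent_space :: "'a::real_normed_vector set \<Rightarrow> 'a \<Rightarrow> 'a set" where
  "tangent_space M x = {v. \<exists>c. curve_on M c x \<and> (c has_vector_derivative v) (at 0)}"

definition has_manifold_gradient ::
    "'a::real_inner set \<Rightarrow> ('a \<Rightarrow> real) \<Rightarrow> 'a \<Rightarrow> 'a \<Rightarrow> bool" where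
  "has_manifold_gradient M U x w \<longleftrightarrow>
    w \<in> tangent_space M x \<and>
    (\<forall>c v. curve_on M c x \<longrightarrow> (c has_vector_derivative v) (at 0) \<longrightarrow>
      ((\<lambda>t. U (c t)) has_real_derivative w \<bullet> v) (at 0))"

lemma has_manifold_gradient_unique:
  assumes "has_manifold_gradient M U x w" "has_manifold_gradient M U x w'"
  shows "w = w'"
proof -
  have eq: "w \<bullet> v = w' \<bullet> v" if "v \<in> tangent_space M x" for v
    using assms that unfolding has_manifold_gradient_def tangent_space_def
    by (blast intro: DERIV_unique)
  have "w \<in> tangent_space M x" "w' \<in> tangent_space M x"
    using assms by (auto simp: has_manifold_gradient_def)
  from eq[OF this(1)] eq[OF this(2)] have "(w - w') \<bullet> (w - w') = 0"
    by (simp add: inner_diff_left inner_diff_right)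
  then show ?thesis by simp
qed


section \<open>Newtonian dynamics on a manifold\<close>

text \<open>
  The derivative of the velocity field \<open>p\<close> along the curve \<open>q\<close> on \<open>M\<close> is the covariant derivative:
  the component tangent to \<open>M\<close> of the derivative taken in the ambient space. The normal component of
  the acceleration is the constraint force that keeps the particle on \<open>M\<close>; on a curved manifold it
  does not vanish in general. If it happens to vanish, the covariant derivative is the ambient one
  (see \<open>newtonian_solution_ambientI\<close>).
\<close>

definition has_covariant_derivative ::
    "'a::real_inner set \<Rightarrow> (real \<Rightarrow> 'a) \<Rightarrow> (real \<Rightarrow> 'a) \<Rightarrow> 'a \<Rightarrow> real \<Rightarrow> real set \<Rightarrow> bool" where
  "has_covariant_derivative M q p b t I \<longleftrightarrow>
    b \<in> tangent_space M (q t) \<and>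
    (\<exists>a. (p has_vector_derivative a) (at t within I) \<and>
         (\<forall>v\<in>tangent_space M (q t). (a - b) \<bullet> v = 0))"

definition newtonian_solution ::
    "'a::real_inner set \<Rightarrow> ('a \<Rightarrow> real) \<Rightarrow> real set \<Rightarrow> (real \<Rightarrow> 'a) \<Rightarrow> (real \<Rightarrow> 'a) \<Rightarrow> bool" where
  "newtonian_solution M U I q p \<longleftrightarrow>
    (\<forall>t\<in>I. q t \<in> M \<and> p t \<in> tangent_space M (q t) \<and>
      (q has_vector_derivative p t) (at t within I) \<and>
      (\<exists>w. has_manifold_gradient M U (q t) w \<and> has_covariant_derivative M q p (- w) t I))"

lemma tangent_space_uminus:
  assumes "v \<in> tangent_space M x"
  shows "- v \<in> tangent_space M x"
proof -
  obtain c e where c: "c 0 = x" "(c has_vector_derivative v) (at 0)" "e > 0"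
    and ce: "\<And>t. \<bar>t\<bar> < e \<Longrightarrow> c t \<in> M \<and> c differentiable (at t)"
    using assms unfolding tangent_space_def curve_on_def by blast
  have vd: "((\<lambda>t. c (- t)) has_vector_derivative - u) (at t)"
    if "(c has_vector_derivative u) (at (- t))" for t u
  proof -
    have "(c \<circ> uminus has_vector_derivative (- 1) *\<^sub>R u) (at t)"
      by (rule vector_diff_chain_at) (use that in \<open>auto intro!: derivative_eq_intros\<close>)
    then show ?thesis by (simp add: comp_def)
  qed
  have "(\<lambda>t. c (- t)) differentiable (at t)" if "\<bar>t\<bar> < e" for t
  proof -
    from ce[of "- t"] that obtain u where "(c has_vector_derivative u) (at (- t))"
      by (auto simp: vector_derivative_works)
    from vd[OF this] show ?thesis
      by (auto simp: has_vector_derivative_def differentiable_def)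
  qed
  then have "curve_on M (\<lambda>t. c (- t)) x"
    unfolding curve_on_def using c(1,3) ce by (auto intro!: exI[of _ e])
  with vd[of v 0] c(2) show ?thesis
    unfolding tangent_space_def by auto
qed

lemma newtonian_solution_ambientI:
  assumes "\<And>t. t \<in> I \<Longrightarrow> q t \<in> M \<and> p t \<in> tangent_space M (q t)"
    and "\<And>t. t \<in> I \<Longrightarrow> (q has_vector_derivative p t) (at t within I)"
    and "\<And>t. t \<in> I \<Longrightarrow> has_manifold_gradient M U (q t) (w t)"
    and "\<And>t. t \<in> I \<Longrightarrow> (p has_vector_derivative - w t) (at t within I)"
  shows "newtonian_solution M U I q p"
  unfolding newtonian_solution_def
proof (intro ballI conjI)
  fix t assume t: "t \<in> I"
  have "w t \<in> tangent_space M (q t)"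
    using assms(3)[OF t] by (simp add: has_manifold_gradient_def)
  then have "has_covariant_derivative M q p (- w t) t I"
    unfolding has_covariant_derivative_def
    using tangent_space_uminus assms(4)[OF t] by (auto intro!: exI[of _ "- w t"])
  with assms(3)[OF t]
  show "\<exists>w. has_manifold_gradient M U (q t) w \<and> has_covariant_derivative M q p (- w) t I"
    by blast
qed (use assms(1,2) in auto)


section \<open>Hamiltonian dynamics\<close>

definition hamiltonian_solution ::
    "('a::real_inner \<Rightarrow> 'a \<Rightarrow> real) \<Rightarrow> real set \<Rightarrow> (real \<Rightarrow> 'a) \<Rightarrow> (real \<Rightarrow> 'a) \<Rightarrow> bool" where
  "hamiltonian_solution H I q p \<longleftrightarrow>
    (\<forall>t\<in>I. \<exists>Hq Hp.
      GDERIV (\<lambda>x. H x (p t)) (q t) :> Hq \<and>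
      GDERIV (\<lambda>y. H (q t) y) (p t) :> Hp \<and>
      (q has_vector_derivative Hp) (at t within I) \<and>
      (p has_vector_derivative - Hq) (at t within I))"

definition metric :: "(real ^ 'd::finite \<Rightarrow> real ^ 'n::finite) \<Rightarrow> real ^ 'd \<Rightarrow> real ^ 'd ^ 'd" where
  "metric g x = transpose (jacobian g (at x)) ** jacobian g (at x)"

definition riemannian_hamiltonian ::
    "(real ^ 'd::finite \<Rightarrow> real ^ 'n::finite) \<Rightarrow> (real ^ 'd \<Rightarrow> real) \<Rightarrow> real ^ 'd \<Rightarrow> real ^ 'd \<Rightarrow> real" where
  "riemannian_hamiltonian g \<pi> x p =
    - ln (\<pi> x) + ln (det (metric g x) powr (1/2)) + 1/2 * (p \<bullet> (matrix_inv (metric g x) *v p))"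


section \<open>Densities\<close>

definition prob_density :: "('a::euclidean_space \<Rightarrow> real) \<Rightarrow> bool" where
  "prob_density \<pi> \<longleftrightarrow>
    \<pi> \<in> borel_measurable borel \<and> (\<forall>x. 0 \<le> \<pi> x) \<and> prob_space (density lborel (\<lambda>x. ennreal (\<pi> x)))"

text \<open>
  The density, with respect to the volume measure of \<open>M\<close>, of the image under \<open>g\<close> of a random variable
  with density \<open>\<pi>\<close>. Densities are determined only almost everywhere; this is the version
  given pointwise by the generalized change of variables formula. It is meaningful only on
  \<open>M = range g\<close>.
\<close>

definition pushforward_density ::
    "(real ^ 'd::finite \<Rightarrow> real ^ 'n::finite) \<Rightarrow> (real ^ 'd \<Rightarrow> real) \<Rightarrow> real ^ 'n \<Rightarrow> real" where
  "pushforward_density g \<pi> y = det (metric g (inv g y)) powr (- 1/2) * \<pi> (inv g y)"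

end

theory Submission
  imports Defs
begin

text \<open>
  Write \<open>J\<close> for the Jacobian of \<open>g\<close> and \<open>G = J\<^sup>T J\<close>. By invariance of domain the inverse of \<open>g\<close> is
  continuous on \<open>M\<close>, so curves on \<open>M\<close> lift to differentiable curves \<open>\<theta>\<close>, and the tangent space is
  the range of \<open>J\<close>. Hence \<open>p = J u\<close> with \<open>u = \<theta>' = G\<^sup>-\<^sup>1 J\<^sup>T p\<close>, which is the first Hamilton equation.
  For the second, \<open>(J\<^sup>T p)' = J\<^sup>T p' + B(u)\<^sup>T p\<close>, where \<open>B\<close> is the derivative of \<open>J\<close>. The
  matrix \<open>J\<^sup>T\<close> annihilates the constraint force, so the first summand is minus the gradient of the
  potential pulled back by \<open>g\<close>. The second summand is minus the gradient of the kinetic energy, whose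
  derivative in direction \<open>h\<close> is \<open>- p \<bullet> B(h) u\<close>, because \<open>B(h) u = B(u) h\<close> by the symmetry of second
  derivatives. This symmetry is needed at a point where \<open>J\<close> is only differentiable.
\<close>

section \<open>Symmetry of second derivatives at a single point\<close>

text \<open>The mean value theorem is applied along \<open>v\<close> to the increment of
  \<open>f\<close> in direction \<open>u\<close>. It yields a difference of values of
  \<open>\<lambda>y. f' y v\<close> at two points near \<open>x\<close>, and each is compared with
  the value at \<open>x\<close>, so differentiability at that one point suffices.\<close>

lemma second_difference_limit:
  fixes f :: "'a::real_normed_vector \<Rightarrow> real"
  assumes f: "\<And>y. (f has_derivative f' y) (at y)"
    and F: "((\<lambda>y. f' y v) has_derivative F) (at x)"
  shows "((\<lambda>s. (f (x + s *\<^sub>R u + s *\<^sub>R v) - f (x + s *\<^sub>R u) - f (x + s *\<^sub>R v) + f x) / s\<^sup>2)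
           \<longlongrightarrow> F u) (at_right 0)"
proof (rule tendstoI)
  fix e :: real assume "0 < e"
  \<comment> \<open>The increments \<open>?a\<close> and \<open>?b\<close> below each have norm at
    most \<open>s * (norm u + norm v)\<close>, so their sum is at most \<open>s * C\<close>; the
    summand 1 keeps \<open>C\<close> positive when \<open>u\<close> and \<open>v\<close>
    vanish.\<close>
  define C where "C = 2 * (norm u + norm v) + 1"
  have "C > 0" unfolding C_def by (simp add: add_nonneg_pos)
  define e' where "e' = e / (2 * C)"
  have "e' > 0" using \<open>0 < e\<close> \<open>C > 0\<close> by (simp add: e'_def)
  interpret F: bounded_linear F using F by (rule has_derivative_bounded_linear)
  obtain d where "d > 0"
    and d: "\<And>y. norm (y - x) < d \<Longrightarrow> \<bar>f' y v - f' x v - F (y - x)\<bar> \<le> e' * norm (y - x)"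
    using F \<open>e' > 0\<close> unfolding has_derivative_at_alt by (auto simp: real_norm_def)
  have bound: "dist ((f (x + s *\<^sub>R u + s *\<^sub>R v) - f (x + s *\<^sub>R u) - f (x + s *\<^sub>R v) + f x) / s\<^sup>2) (F u) < e"
    if s: "0 < s" "s < d / C" for s
  proof -
    have sC: "s * C < d" using s \<open>C > 0\<close> by (simp add: pos_less_divide_eq)
    \<comment> \<open>The second difference is \<open>h s - h 0\<close>. With the step along
      \<open>u\<close> frozen, one intermediate \<open>z\<close> serves both evaluation
      points.\<close>
    define h where "h \<tau> = f (x + s *\<^sub>R u + \<tau> *\<^sub>R v) - f (x + \<tau> *\<^sub>R v)" for \<tau>
    have line: "((\<lambda>\<tau>. f (y + \<tau> *\<^sub>R v)) has_real_derivative f' (y + \<tau> *\<^sub>R v) v) (at \<tau>)" for y \<tau>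
    proof -
      have "((\<lambda>\<tau>. y + \<tau> *\<^sub>R v) has_derivative (\<lambda>k. k *\<^sub>R v)) (at \<tau>)"
        by (auto intro!: derivative_eq_intros)
      from has_derivative_compose[OF this f] show ?thesis
        unfolding has_field_derivative_def
        by (simp add: linear_cmul[OF has_derivative_linear[OF f]] mult.commute[of _ "f' (y + \<tau> *\<^sub>R v) v"])
    qed
    have h': "(h has_real_derivative (f' (x + s *\<^sub>R u + \<tau> *\<^sub>R v) v - f' (x + \<tau> *\<^sub>R v) v)) (at \<tau>)" for \<tau>
      unfolding h_def by (intro DERIV_diff line)
    from MVT2[OF s(1) h'] obtain z where z: "0 < z" "z < s"
      and hz: "h s - h 0 = s * (f' (x + s *\<^sub>R u + z *\<^sub>R v) v - f' (x + z *\<^sub>R v) v)"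
      by (auto simp: algebra_simps)
    let ?a = "s *\<^sub>R u + z *\<^sub>R v" and ?b = "z *\<^sub>R v"
    have nb: "norm ?b \<le> s * norm v" using z by (simp add: mult_right_mono)
    have "norm ?a \<le> norm (s *\<^sub>R u) + norm ?b" by (rule norm_triangle_ineq)
    also have "\<dots> \<le> s * (norm u + norm v)" using nb s by (simp add: distrib_left)
    finally have na: "norm ?a \<le> s * (norm u + norm v)" .
    have "s * norm v \<le> s * (norm u + norm v)" using s by simp
    moreover have "s * C = s * (norm u + norm v) + s * (norm u + norm v) + s"
      by (simp add: C_def algebra_simps)
    ultimately have "norm ?a + norm ?b \<le> s * C" using na nb s by linarith
    then have n: "norm ?a + norm ?b \<le> s * C" "norm ?a < d" "norm ?b < d"
      using sC norm_ge_zero[of ?a] norm_ge_zero[of ?b] by linarith+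
    have 1: "\<bar>f' (x + s *\<^sub>R u + z *\<^sub>R v) v - f' x v - F ?a\<bar> \<le> e' * norm ?a"
      using d[of "x + s *\<^sub>R u + z *\<^sub>R v"] n by (simp add: add.assoc)
    have 2: "\<bar>f' (x + z *\<^sub>R v) v - f' x v - F ?b\<bar> \<le> e' * norm ?b"
      using d[of "x + z *\<^sub>R v"] n by simp
    have "F ?a - F ?b = s * F u" by (simp add: F.add F.scaleR)
    then have "\<bar>(f' (x + s *\<^sub>R u + z *\<^sub>R v) v - f' (x + z *\<^sub>R v) v) - s * F u\<bar> \<le> e' * (norm ?a + norm ?b)"
      using 1 2 unfolding distrib_left by linarith
    also have "\<dots> \<le> e' * (s * C)" using n \<open>e' > 0\<close> by (intro mult_left_mono) auto
    also have "\<dots> = s * (e / 2)" using \<open>C > 0\<close> by (simp add: e'_def)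
    finally have "\<bar>(h s - h 0) / s - s * F u\<bar> \<le> s * (e / 2)" using hz s by simp
    then have "\<bar>(h s - h 0) / s - s * F u\<bar> / s \<le> e / 2" using s by (simp add: divide_le_eq mult.commute)
    moreover have "\<bar>(h s - h 0) / s - s * F u\<bar> / s = \<bar>(h s - h 0) / s\<^sup>2 - F u\<bar>"
    proof -
      have "\<bar>(h s - h 0) / s - s * F u\<bar> / s = \<bar>((h s - h 0) / s - s * F u) / s\<bar>"
        using s by simp
      also have "((h s - h 0) / s - s * F u) / s = (h s - h 0) / s\<^sup>2 - F u"
        using s by (simp add: field_simps power2_eq_square)
      finally show ?thesis .
    qed
    ultimately have "\<bar>(h s - h 0) / s\<^sup>2 - F u\<bar> < e" using \<open>0 < e\<close> by linarith
    then show ?thesis by (simp add: h_def dist_real_def algebra_simps)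
  qed
  show "\<forall>\<^sub>F s in at_right 0. dist ((f (x + s *\<^sub>R u + s *\<^sub>R v) - f (x + s *\<^sub>R u) - f (x + s *\<^sub>R v) + f x) / s\<^sup>2) (F u) < e"
    unfolding eventually_at_right_field
    using bound \<open>d > 0\<close> \<open>C > 0\<close> by (intro exI[of _ "d / C"]) auto
qed

text \<open>The second difference is symmetric in \<open>u\<close> and \<open>v\<close>, so both
  mixed derivatives are limits of the same quotient.\<close>

lemma mixed_derivatives_eq:
  fixes f :: "'a::real_normed_vector \<Rightarrow> real"
  assumes f: "\<And>y. (f has_derivative f' y) (at y)"
    and Fu: "((\<lambda>y. f' y u) has_derivative Fu) (at x)"
    and Fv: "((\<lambda>y. f' y v) has_derivative Fv) (at x)"
  shows "Fu v = Fv u"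
proof (rule tendsto_unique)
  let ?\<Delta> = "\<lambda>s. (f (x + s *\<^sub>R u + s *\<^sub>R v) - f (x + s *\<^sub>R u) - f (x + s *\<^sub>R v) + f x) / s\<^sup>2"
  show "(?\<Delta> \<longlongrightarrow> Fv u) (at_right 0)"
    by (rule second_difference_limit[OF f Fv])
  have "?\<Delta> = (\<lambda>s. (f (x + s *\<^sub>R v + s *\<^sub>R u) - f (x + s *\<^sub>R v) - f (x + s *\<^sub>R u) + f x) / s\<^sup>2)"
    by (simp add: algebra_simps)
  then show "(?\<Delta> \<longlongrightarrow> Fu v) (at_right 0)"
    using second_difference_limit[OF f Fu, of v] by simp
qed simp

section \<open>Determinants and the derivative of a matrix inverse\<close>

text \<open>The determinant does not vanish on the segment from the identity matrix to \<open>A\<close>.\<close>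

lemma det_pos_if_positive_definite:
  fixes A :: "real ^ 'n ^ 'n"
  assumes A: "\<And>x. x \<noteq> 0 \<Longrightarrow> 0 < x \<bullet> (A *v x)"
  shows "0 < det A"
proof (rule ccontr)
  assume "\<not> 0 < det A"
  define P where "P s = (1 - s) *\<^sub>R mat 1 + s *\<^sub>R A" for s :: real
  have cont: "continuous_on {0..1} (\<lambda>s. det (P s))"
    unfolding P_def det_def by (intro continuous_intros)
  have "det (P 1) \<le> 0" "0 \<le> det (P 0)"
    using \<open>\<not> 0 < det A\<close> by (simp_all add: P_def)
  then obtain s where s: "0 \<le> s" "s \<le> 1" "det (P s) = 0"
    using IVT2'[of "\<lambda>s. det (P s)" 1 0 0] cont by auto
  \<comment> \<open>A singular \<open>P s\<close> has a kernel vector, at which its quadratic form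
    vanishes, although that form is a convex combination of two positive ones.\<close>
  then obtain x where x: "x \<noteq> 0" "P s *v x = 0"
    using invertible_det_nz[of "P s"] invertible_left_inverse[of "P s"]
      matrix_left_invertible_ker[of "P s"] by blast
  have "x \<bullet> (P s *v x) = (1 - s) * (x \<bullet> x) + s * (x \<bullet> (A *v x))"
    by (simp add: P_def matrix_vector_mult_add_rdistrib scaleR_matrix_vector_assoc[symmetric] inner_add_right)
  also have "\<dots> > 0"
  proof (cases "s = 0")
    case False
    then show ?thesis using s A[OF x(1)] by (intro add_nonneg_pos mult_pos_pos mult_nonneg_nonneg) auto
  qed (use x in simp)
  finally show False using x by simp
qed

lemma differentiable_prod:
  fixes f :: "'i \<Rightarrow> 'a::real_normed_vector \<Rightarrow> 'b::real_normed_field"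
  assumes "\<And>i. i \<in> I \<Longrightarrow> f i differentiable (at x within S)"
  shows "(\<lambda>y. \<Prod>i\<in>I. f i y) differentiable (at x within S)"
  using assms has_derivative_prod[of I f _ x S] unfolding differentiable_def by metis

lemma differentiable_vec_nth:
  "f differentiable F \<Longrightarrow> (\<lambda>y. f y $ i) differentiable F"
  unfolding differentiable_def
  using bounded_linear.has_derivative[OF bounded_linear_vec_nth] by blast

lemma differentiable_det:
  fixes A :: "'a::real_normed_vector \<Rightarrow> real ^ 'n ^ 'n"
  assumes "\<And>i j. (\<lambda>y. A y $ i $ j) differentiable (at x within S)"
  shows "(\<lambda>y. det (A y)) differentiable (at x within S)"
  unfolding det_def
  by (intro differentiable_sum differentiable_mult differentiable_prod differentiable_const assms ballI)
    (auto intro: finite_permutations)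

lemma bounded_bilinear_matrix_vector_mult:
  "bounded_bilinear ((*v) :: real ^ 'm ^ 'n \<Rightarrow> real ^ 'm \<Rightarrow> real ^ 'n)"
  unfolding bilinear_conv_bounded_bilinear[symmetric] bilinear_def
  by (auto intro!: linearI simp: algebra_simps matrix_vector_mult_scaleR scaleR_matrix_vector_assoc
      matrix_vector_mult_add_rdistrib matrix_vector_right_distrib)

lemma bounded_bilinear_matrix_matrix_mult:
  "bounded_bilinear ((**) :: real ^ 'm ^ 'n \<Rightarrow> real ^ 'k ^ 'm \<Rightarrow> real ^ 'k ^ 'n)"
  unfolding bilinear_conv_bounded_bilinear[symmetric] bilinear_def
  by (auto intro!: linearI simp: vec_eq_iff matrix_matrix_mult_def sum_distrib_left sum.distrib algebra_simps)

lemma bounded_linear_transpose: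
  "bounded_linear (transpose :: real ^ 'm ^ 'n \<Rightarrow> real ^ 'n ^ 'm)"
  unfolding linear_linear
  by (auto intro!: linearI simp: transpose_def vec_eq_iff)

lemma matrix_inv_works:
  fixes A :: "real ^ 'n ^ 'n"
  assumes "invertible A"
  shows matrix_inv_right: "A ** matrix_inv A = mat 1" and matrix_inv_left: "matrix_inv A ** A = mat 1"
  using someI_ex[OF assms[unfolded invertible_def]] by (simp_all add: matrix_inv_def)

lemma has_derivative_matrix_inv_vector:
  fixes G :: "'a::real_normed_vector \<Rightarrow> real ^ 'n ^ 'n"
  assumes G: "(G has_derivative G') (at x)" and inv: "invertible (G x)"
  shows "((\<lambda>y. matrix_inv (G y) *v b) has_derivative
           (\<lambda>h. - (matrix_inv (G x) *v (G' h *v (matrix_inv (G x) *v b))))) (at x)"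
proof -
  define u where "u y = matrix_inv (G y) *v b" for y
  have nth: "(\<lambda>y. G y $ i $ j) differentiable (at x)" for i j
    using G by (intro differentiable_vec_nth) (auto simp: differentiable_def)
  have dG: "(\<lambda>y. det (G y)) differentiable (at x)"
    by (rule differentiable_det) (rule nth)
  then have "isCont (\<lambda>y. det (G y)) x"
    by (rule differentiable_imp_continuous_within)
  moreover have "det (G x) \<noteq> 0" using inv by (simp add: invertible_det_nz)
  \<comment> \<open>For singular \<open>G y\<close> the value of \<open>matrix_inv\<close> is an
    arbitrary choice, so the identities below are used only near \<open>x\<close>.\<close>
  ultimately have ev: "\<forall>\<^sub>F y in at x. det (G y) \<noteq> 0"
    unfolding isCont_def by (rule tendsto_imp_eventually_ne)
  have Gu: "G y *v u y = b" if "det (G y) \<noteq> 0" for y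
    using that by (simp add: u_def matrix_vector_mul_assoc matrix_inv_right invertible_det_nz)
  have cram: "u y = (\<chi> k. det (\<chi> i j. if j = k then b $ i else G y $ i $ j) / det (G y))"
    if "det (G y) \<noteq> 0" for y
    using cramer[OF that] Gu[OF that] by blast
  have "(\<lambda>y. \<chi> k. det (\<chi> i j. if j = k then b $ i else G y $ i $ j) / det (G y)) differentiable (at x)"
    (is "?c differentiable _")
  proof -
    have "(\<lambda>y. det (\<chi> i j. if j = k then b $ i else G y $ i $ j) / det (G y)) differentiable (at x)" for k
    proof (rule differentiable_divide[OF differentiable_det dG \<open>det (G x) \<noteq> 0\<close>])
      show "(\<lambda>y. (\<chi> i j. if j = k then b $ i else G y $ i $ j) $ i $ j) differentiable (at x)" for i j
        by (cases "j = k") (simp_all add: nth)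
    qed
    then have "(\<lambda>y. \<Sum>k\<in>UNIV. (det (\<chi> i j. if j = k then b $ i else G y $ i $ j) / det (G y)) *\<^sub>R axis k (1::real))
        differentiable (at x)"
      by (intro differentiable_sum differentiable_scaleR) auto
    then show ?thesis
      by (simp add: scalar_mult_eq_scaleR[symmetric] basis_expansion[of "\<chi> k. _ k", simplified])
  qed
  then obtain u' where "(?c has_derivative u') (at x)" by (auto simp: differentiable_def)
  \<comment> \<open>Cramer's rule gives differentiability; the formula for the derivative then follows by
    differentiating \<open>G y *v u y = b\<close>.\<close>
  then have u': "(u has_derivative u') (at x)"
    using ev cram \<open>det (G x) \<noteq> 0\<close>
    by (elim has_derivative_transform_eventually) (auto elim!: eventually_mono)
  have "((\<lambda>y. G y *v u y) has_derivative (\<lambda>h. G x *v u' h + G' h *v u x)) (at x)"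
    by (rule bounded_bilinear.FDERIV[OF bounded_bilinear_matrix_vector_mult G u'])
  then have "((\<lambda>y. b) has_derivative (\<lambda>h. G x *v u' h + G' h *v u x)) (at x)"
    using ev Gu \<open>det (G x) \<noteq> 0\<close>
    by (elim has_derivative_transform_eventually) (auto elim!: eventually_mono)
  then have "(\<lambda>h. G x *v u' h + G' h *v u x) = (\<lambda>h. 0)"
    by (rule has_derivative_unique) simp
  then have "G x *v u' h = - (G' h *v u x)" for h
    by (metis eq_neg_iff_add_eq_0)
  then have "matrix_inv (G x) *v (G x *v u' h) = - (matrix_inv (G x) *v (G' h *v u x))" for h
    by (simp add: linear_neg[OF matrix_vector_mul_linear])
  then have "u' = (\<lambda>h. - (matrix_inv (G x) *v (G' h *v u x)))"
    using inv by (auto simp: matrix_vector_mul_assoc matrix_inv_left)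
  then show ?thesis using u' by (simp add: u_def[abs_def])
qed

section \<open>Differentiating a lifted curve\<close>

text \<open>Applying \<open>L\<close> to the first-order expansion of \<open>g\<close> at
  \<open>\<theta> t\<close> recovers \<open>\<theta> s - \<theta> t\<close> from
  \<open>g (\<theta> s) - g (\<theta> t)\<close> up to an error small relative to
  \<open>\<theta> s - \<theta> t\<close>. This first gives a Lipschitz bound, which then makes the
  error small relative to \<open>s - t\<close>.\<close>

lemma has_vector_derivative_lift:
  fixes g :: "'a::real_normed_vector \<Rightarrow> 'b::real_normed_vector"
  assumes g: "(g has_derivative g') (at (\<theta> t))"
    and L: "bounded_linear L" and Lg': "\<And>h. L (g' h) = h"
    and cont: "continuous (at t within S) \<theta>"
    and g\<theta>: "((\<lambda>s. g (\<theta> s)) has_vector_derivative v) (at t within S)"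
  shows "(\<theta> has_vector_derivative L v) (at t within S)"
proof -
  interpret L: bounded_linear L by (rule L)
  obtain K where K: "K > 0" "\<And>x. norm (L x) \<le> K * norm x"
    using L.pos_bounded by (auto simp: mult.commute)
  let ?F = "at t within S"
  have small_g: "\<forall>\<^sub>F s in ?F. norm (g (\<theta> s) - g (\<theta> t) - g' (\<theta> s - \<theta> t)) \<le> e * norm (\<theta> s - \<theta> t)"
    if e: "e > 0" for e
  proof -
    obtain d where d: "d > 0"
      "\<And>y. norm (y - \<theta> t) < d \<Longrightarrow> norm (g y - g (\<theta> t) - g' (y - \<theta> t)) \<le> e * norm (y - \<theta> t)"
      using g e unfolding has_derivative_at_alt by blast
    have "\<forall>\<^sub>F s in ?F. dist (\<theta> s) (\<theta> t) < d"
      using cont d(1) by (auto simp: continuous_within intro: tendstoD)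
    then show ?thesis by (rule eventually_mono) (use d(2) in \<open>auto simp: dist_norm\<close>)
  qed
  have small_q: "\<forall>\<^sub>F s in ?F. norm (g (\<theta> s) - g (\<theta> t) - (s - t) *\<^sub>R v) \<le> e * \<bar>s - t\<bar>" if "e > 0" for e
    using g\<theta> that unfolding has_vector_derivative_def has_derivative_within_alt2 by simp
  \<comment> \<open>The 2 comes from absorbing half of \<open>norm (\<theta> s - \<theta> t)\<close>
    on the left, hence the tolerance \<open>1 / (2 * K)\<close> below; the 1 comes from estimating
    the remainder of the curve \<open>g (\<theta> s)\<close> with tolerance 1.\<close>
  define D where "D = 2 * K * (norm v + 1)"
  have "D > 0" using K by (auto simp: D_def intro!: mult_pos_pos add_nonneg_pos)
  have split: "\<theta> s - \<theta> t = L (g (\<theta> s) - g (\<theta> t)) - L (g (\<theta> s) - g (\<theta> t) - g' (\<theta> s - \<theta> t))" for s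
    by (simp add: L.diff Lg')
  have lip: "\<forall>\<^sub>F s in ?F. norm (\<theta> s - \<theta> t) \<le> D * \<bar>s - t\<bar>"
  proof -
    have "1 / (2 * K) > 0" using K by simp
    from small_g[OF this] small_q[OF zero_less_one] show ?thesis
    proof eventually_elim
      case (elim s)
      have "norm (\<theta> s - \<theta> t) \<le> K * norm (g (\<theta> s) - g (\<theta> t))
          + K * norm (g (\<theta> s) - g (\<theta> t) - g' (\<theta> s - \<theta> t))"
        by (subst split) (rule order_trans[OF norm_triangle_ineq4 add_mono[OF K(2) K(2)]])
      also have "K * norm (g (\<theta> s) - g (\<theta> t) - g' (\<theta> s - \<theta> t)) \<le> norm (\<theta> s - \<theta> t) / 2"
        using mult_left_mono[OF elim(1), of K] K(1) by simp
      finally have "norm (\<theta> s - \<theta> t) \<le> 2 * (K * norm (g (\<theta> s) - g (\<theta> t)))" by simp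
      moreover have "norm (g (\<theta> s) - g (\<theta> t)) \<le> \<bar>s - t\<bar> * norm v + \<bar>s - t\<bar>"
        using elim(2) norm_triangle_ineq2[of "g (\<theta> s) - g (\<theta> t)" "(s - t) *\<^sub>R v"] by simp
      then have "K * norm (g (\<theta> s) - g (\<theta> t)) \<le> K * (\<bar>s - t\<bar> * norm v + \<bar>s - t\<bar>)"
        using K(1) by (intro mult_left_mono) auto
      ultimately show ?case by (simp add: D_def algebra_simps)
    qed
  qed
  have "\<forall>\<^sub>F s in ?F. norm (\<theta> s - \<theta> t - (s - t) *\<^sub>R L v) \<le> e * norm (s - t)" if e: "e > 0" for e
  proof -
    \<comment> \<open>\<open>L\<close> costs a factor \<open>K\<close> and the Lipschitz bound a
      factor \<open>D\<close>; with these tolerances each remainder contributes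
      \<open>e / 2 * \<bar>s - t\<bar>\<close>.\<close>
    have "e / (2 * K * D) > 0" "e / (2 * K) > 0" using e K \<open>D > 0\<close> by simp_all
    from small_g[OF this(1)] small_q[OF this(2)] lip show ?thesis
    proof eventually_elim
      case (elim s)
      let ?r = "g (\<theta> s) - g (\<theta> t) - g' (\<theta> s - \<theta> t)" and ?r' = "g (\<theta> s) - g (\<theta> t) - (s - t) *\<^sub>R v"
      have "\<theta> s - \<theta> t - (s - t) *\<^sub>R L v = L ?r' - L ?r"
        by (simp add: L.diff L.scaleR Lg')
      then have "norm (\<theta> s - \<theta> t - (s - t) *\<^sub>R L v) \<le> K * norm ?r' + K * norm ?r"
        using order_trans[OF norm_triangle_ineq4 add_mono[OF K(2) K(2)]] by metis
      also have "K * norm ?r' \<le> e / 2 * \<bar>s - t\<bar>"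
        using mult_left_mono[OF elim(2), of K] K(1) by simp
      also have "K * norm ?r \<le> K * (e / (2 * K * D) * (D * \<bar>s - t\<bar>))"
        using elim(1,3) K(1) \<open>D > 0\<close> e
        by (intro mult_left_mono order_trans[OF elim(1)] divide_nonneg_pos) auto
      also have "\<dots> = e / 2 * \<bar>s - t\<bar>" using K(1) \<open>D > 0\<close> by simp
      finally show ?case by simp
    qed
  qed
  then show ?thesis
    unfolding has_vector_derivative_def has_derivative_within_alt2
    by (simp add: bounded_linear_scaleR_left)
qed

lemma inner_transpose_matrix_vector:
  fixes A :: "real ^ 'm ^ 'n"
  shows "x \<bullet> (transpose A *v y) = (A *v x) \<bullet> y"
  by (metis dot_lmul_matrix inner_commute transpose_matrix_vector)

lemma GDERIV_exists:
  fixes f :: "'a::euclidean_space \<Rightarrow> real"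
  assumes "f differentiable (at x)"
  obtains D where "GDERIV f x :> D"
proof -
  obtain f' where f': "(f has_derivative f') (at x)" using assms by (auto simp: differentiable_def)
  \<comment> \<open>Riesz representation: the adjoint of the functional, evaluated at 1, is the
    representing vector.\<close>
  have "f' = (\<lambda>h. h \<bullet> adjoint f' 1)"
    using adjoint_works[OF has_derivative_linear[OF f'], of _ 1] by auto
  with f' have "GDERIV f x :> adjoint f' 1" by (simp add: gderiv_def)
  then show thesis by (rule that)
qed

section \<open>Continuity of the inverse parametrization, and tangent vectors\<close>

text \<open>Read in a chart, \<open>g\<close> is an injective continuous map between open subsets of \<open>\<real>\<^sup>d\<close>, so
  invariance of domain applies.\<close>

lemma continuous_on_inv_parametrization:
  fixes g :: "real ^ 'd \<Rightarrow> real ^ 'n"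
  assumes M: "submanifold TYPE('d) M" and g: "parametrization g M"
  shows "continuous_on M (inv g)"
  unfolding continuous_on_eq_continuous_within
proof
  fix x assume x: "x \<in> M"
  have "inj g" and rng: "range g = M" and diff: "\<And>y. g differentiable (at y)"
    using g by (auto simp: parametrization_def bij_betw_def)
  then have cg: "continuous_on S g" for S
    by (intro continuous_at_imp_continuous_on ballI differentiable_imp_continuous_within)
  obtain U V and \<phi> :: "real ^ 'd \<Rightarrow> real ^ 'n" and \<psi>
    where U: "open U" "x \<in> U" and V: "open V" and hom: "homeomorphism V (M \<inter> U) \<phi> \<psi>"
    using M[unfolded submanifold_def, rule_format, OF x] by (elim exE conjE) (rule that)
  define W where "W = g -` U"
  have "open W" using U(1) cg[of UNIV] by (simp add: W_def open_vimage)
  have gW: "g ` W = M \<inter> U" using rng by (auto simp: W_def)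
  have "continuous_on ((\<psi> \<circ> g) ` W) (inv g \<circ> \<phi>)"
  proof (rule continuous_on_inverse_open[OF \<open>open W\<close>])
    show "continuous_on W (\<psi> \<circ> g)"
      using hom cg gW by (intro continuous_on_compose) (auto simp: homeomorphism_def)
    show "(inv g \<circ> \<phi>) ((\<psi> \<circ> g) y) = y" if "y \<in> W" for y
    proof -
      have "g y \<in> M \<inter> U" using that gW by blast
      then have "\<phi> (\<psi> (g y)) = g y" using hom by (simp add: homeomorphism_def)
      then show ?thesis using \<open>inj g\<close> by simp
    qed
  qed simp
  then have "continuous_on (\<psi> ` (M \<inter> U)) (inv g \<circ> \<phi>)" unfolding image_comp[symmetric] gW .
  with homeomorphism_cont2[OF hom] have "continuous_on (M \<inter> U) ((inv g \<circ> \<phi>) \<circ> \<psi>)"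
    by (rule continuous_on_compose)
  then have "continuous_on (M \<inter> U) (inv g)"
    using hom by (elim continuous_on_eq) (auto simp: homeomorphism_def)
  then have "continuous (at x within (M \<inter> U)) (inv g)"
    using x U by (simp add: continuous_on_eq_continuous_within)
  then show "continuous (at x within M) (inv g)"
    using at_within_nhd[of x U "M \<inter> U" M] U by (simp add: Int_assoc continuous_within)
qed

text \<open>A curve with velocity \<open>v\<close> lifts through \<open>g\<close> to a curve with
  velocity \<open>L v\<close>, and pushing the lift forward recovers \<open>v\<close>. So tangent
  vectors lie in the range of \<open>g'\<close>.\<close>

lemma tangent_vector_inverse:
  fixes g :: "'a::real_normed_vector \<Rightarrow> 'b::real_normed_vector"
  assumes cont: "continuous_on (range g) (inv g)" and "inj g"
    and g': "(g has_derivative g') (at x)"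
    and L: "bounded_linear L" "\<And>h. L (g' h) = h"
    and v: "v \<in> tangent_space (range g) (g x)"
  shows "g' (L v) = v"
proof -
  obtain c e where c: "c 0 = g x" "(c has_vector_derivative v) (at 0)" "e > 0"
    and ce: "\<And>t. \<bar>t\<bar> < e \<Longrightarrow> c t \<in> range g \<and> c differentiable (at t)"
    using v unfolding tangent_space_def curve_on_def by blast
  \<comment> \<open>Only for times in this interval is \<open>c\<close> known to stay on
    \<open>range g\<close>, where \<open>inv g\<close> is a right inverse of
    \<open>g\<close>.\<close>
  define S where "S = {-e<..<e}"
  have S: "0 \<in> S" "open S" using c(3) by (auto simp: S_def)
  define \<theta> where "\<theta> = inv g \<circ> c"
  have g\<theta>: "g (\<theta> s) = c s" if "s \<in> S" for s
    using ce[of s] that by (auto simp: \<theta>_def S_def f_inv_into_f)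
  have "continuous_on S c"
    by (intro continuous_at_imp_continuous_on ballI differentiable_imp_continuous_within) (use ce in \<open>auto simp: S_def\<close>)
  moreover have "continuous_on (c ` S) (inv g)"
    by (rule continuous_on_subset[OF cont]) (use ce in \<open>auto simp: S_def\<close>)
  ultimately have "continuous_on S \<theta>" unfolding \<theta>_def by (rule continuous_on_compose)
  then have c\<theta>: "continuous (at 0 within S) \<theta>" using S by (simp add: continuous_on_eq_continuous_within)
  have \<theta>0: "\<theta> 0 = x" using c(1) \<open>inj g\<close> by (simp add: \<theta>_def)
  have dq: "((\<lambda>s. g (\<theta> s)) has_vector_derivative v) (at 0)"
    by (rule has_vector_derivative_transform_within_open[OF c(2) S(2,1)]) (simp add: g\<theta>)
  then have "(\<theta> has_vector_derivative L v) (at 0 within S)"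
    using g' L c\<theta> has_vector_derivative_at_within[OF dq]
    by (intro has_vector_derivative_lift[of g g' \<theta> 0 L S v]) (simp_all only: \<theta>0)
  then have "(\<theta> has_vector_derivative L v) (at 0)" by (simp only: at_within_open[OF S])
  moreover have "(g has_derivative g') (at (\<theta> 0) within range \<theta>)"
    unfolding \<theta>0 using g' by (rule has_derivative_at_withinI)
  ultimately have "((\<lambda>s. g (\<theta> s)) has_vector_derivative g' (L v)) (at 0)"
    using vector_derivative_diff_chain_within[of \<theta> _ 0 UNIV g g'] by (simp add: o_def)
  then show ?thesis using dq by (rule vector_derivative_unique_at)
qed

text \<open>Images of straight lines serve as test curves: they show that the range of
  \<open>g'\<close> consists of tangent vectors, and they evaluate the manifold gradient.\<close>

lemma line_curve:
  fixes g :: "'a::real_normed_vector \<Rightarrow> 'b::real_normed_vector"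
  assumes "\<And>y. g differentiable (at y)" and g': "(g has_derivative g') (at x)"
  shows "curve_on (range g) (\<lambda>s. g (x + s *\<^sub>R h)) (g x)"
    and "((\<lambda>s. g (x + s *\<^sub>R h)) has_vector_derivative g' h) (at 0)"
proof -
  have line: "((\<lambda>s. x + s *\<^sub>R h) has_vector_derivative h) (at s)" for s
    by (auto intro!: derivative_eq_intros)
  have "(\<lambda>s. g (x + s *\<^sub>R h)) differentiable (at s)" for s
    by (rule differentiable_compose[OF assms(1)]) (use line in \<open>auto simp: has_vector_derivative_def differentiable_def\<close>)
  then show "curve_on (range g) (\<lambda>s. g (x + s *\<^sub>R h)) (g x)"
    unfolding curve_on_def using zero_less_one by (intro conjI exI[of _ "1::real"]) simp_all
  have "(g has_derivative g') (at (x + 0 *\<^sub>R h) within range (\<lambda>s. x + s *\<^sub>R h))"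
    using has_derivative_at_withinI[OF g'] by simp
  from vector_derivative_diff_chain_within[OF line this]
  show "((\<lambda>s. g (x + s *\<^sub>R h)) has_vector_derivative g' h) (at 0)"
    by (simp add: o_def)
qed

section \<open>Gram matrices and the kinetic energy\<close>

lemma gram_inner:
  fixes A :: "real ^ 'm ^ 'n"
  shows "x \<bullet> ((transpose A ** A) *v y) = (A *v x) \<bullet> (A *v y)"
  by (simp add: matrix_vector_mul_assoc[symmetric] inner_transpose_matrix_vector del: transpose_matrix_vector)

lemma det_gram_pos:
  fixes A :: "real ^ 'm ^ 'n"
  assumes "inj ((*v) A)"
  shows "0 < det (transpose A ** A)"
proof (rule det_pos_if_positive_definite)
  fix x :: "real ^ 'm" assume "x \<noteq> 0"
  then have "A *v x \<noteq> 0" using assms by (metis injD matrix_vector_mult_0_right)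
  then show "0 < x \<bullet> ((transpose A ** A) *v x)" by (simp add: gram_inner)
qed

text \<open>Testing against a fixed \<open>v\<close> reduces the claim to the mixed second
  derivatives of the real function \<open>v \<bullet> g y\<close>.\<close>

lemma symmetric_jacobian_derivative:
  fixes g :: "real ^ 'd \<Rightarrow> real ^ 'n"
  assumes g: "\<And>y. (g has_derivative (\<lambda>h. J y *v h)) (at y)"
    and J: "(J has_derivative B) (at x)"
  shows "B h *v k = B k *v h"
proof -
  have D: "((\<lambda>y. v \<bullet> (J y *v k)) has_derivative (\<lambda>h. v \<bullet> (B h *v k))) (at x)" for v k
    by (intro has_derivative_inner_right
        bounded_linear.has_derivative[OF bounded_bilinear.bounded_linear_left[OF bounded_bilinear_matrix_vector_mult]] J)
  have "v \<bullet> (B h *v k) = v \<bullet> (B k *v h)" for v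
    by (rule mixed_derivatives_eq[OF has_derivative_inner_right[OF g] D D])
  then show ?thesis using vector_eq_ldot by blast
qed

lemma has_derivative_gram:
  fixes J :: "'a::real_normed_vector \<Rightarrow> real ^ 'm ^ 'n"
  assumes J: "(J has_derivative B) (at x within S)"
  shows "((\<lambda>y. transpose (J y) ** J y) has_derivative
           (\<lambda>h. transpose (J x) ** B h + transpose (B h) ** J x)) (at x within S)"
  by (rule bounded_bilinear.FDERIV[OF bounded_bilinear_matrix_matrix_mult
        bounded_linear.has_derivative[OF bounded_linear_transpose J] J])

text \<open>The momentum \<open>b\<close> is fixed and the metric varies. As
  \<open>b = G x *v u\<close> with \<open>G x\<close> symmetric, differentiating the inverse gives
  minus half the quadratic form, at \<open>u\<close>, of the derivative of \<open>G\<close>; the two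
  summands of the Gram product rule contribute equally, which cancels the half.\<close>

lemma has_derivative_kinetic_energy:
  fixes J :: "real ^ 'd \<Rightarrow> real ^ 'd ^ 'n"
    and b :: "real ^ 'd"
  assumes J: "(J has_derivative B) (at x)" and inj: "inj ((*v) (J x))"
  defines "G \<equiv> \<lambda>y. transpose (J y) ** J y"
  defines "u \<equiv> matrix_inv (G x) *v b"
  shows "((\<lambda>y. 1/2 * (b \<bullet> (matrix_inv (G y) *v b))) has_derivative
           (\<lambda>h. - ((J x *v u) \<bullet> (B h *v u)))) (at x)"
proof -
  have inv: "invertible (G x)" using det_gram_pos[OF inj] by (simp add: G_def invertible_det_nz)
  have bu: "b = G x *v u"
    using inv by (simp add: u_def matrix_vector_mul_assoc matrix_inv_right)
  have G': "(G has_derivative (\<lambda>h. transpose (J x) ** B h + transpose (B h) ** J x)) (at x)"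
    unfolding G_def by (rule has_derivative_gram[OF J])
  have "((\<lambda>y. 1/2 * (b \<bullet> (matrix_inv (G y) *v b))) has_derivative
      (\<lambda>h. 1/2 * (b \<bullet> - (matrix_inv (G x) *v ((transpose (J x) ** B h + transpose (B h) ** J x) *v u))))) (at x)"
    unfolding u_def
    by (intro has_derivative_mult_right has_derivative_inner_right has_derivative_matrix_inv_vector G' inv)
  moreover have "1/2 * (b \<bullet> - (matrix_inv (G x) *v ((transpose (J x) ** B h + transpose (B h) ** J x) *v u)))
      = - ((J x *v u) \<bullet> (B h *v u))" for h
  proof -
    define y where "y = (transpose (J x) ** B h + transpose (B h) ** J x) *v u"
    have "b \<bullet> (matrix_inv (G x) *v y) = u \<bullet> (G x *v (matrix_inv (G x) *v y))"
      unfolding bu using gram_inner[of _ "J x"] by (metis G_def inner_commute)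
    also have "\<dots> = u \<bullet> y" using inv by (simp add: matrix_vector_mul_assoc matrix_inv_right)
    also have "\<dots> = 2 * ((J x *v u) \<bullet> (B h *v u))"
      by (simp add: y_def matrix_vector_mult_add_rdistrib matrix_vector_mul_assoc[symmetric] inner_add_right
          inner_transpose_matrix_vector inner_commute del: transpose_matrix_vector)
    finally show ?thesis by (simp add: y_def)
  qed
  ultimately show ?thesis by simp
qed

text \<open>Here the metric is fixed and the momentum varies. The inverse of the Gram matrix is
  symmetric, so the two summands of the product rule coincide and cancel the half.\<close>

lemma GDERIV_kinetic_energy:
  fixes A :: "real ^ 'd ^ 'n"
  assumes inj: "inj ((*v) A)"
  defines "Gi \<equiv> matrix_inv (transpose A ** A)"
  shows "GDERIV (\<lambda>y. 1/2 * (y \<bullet> (Gi *v y))) b :> Gi *v b"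
proof -
  have inv: "invertible (transpose A ** A)" using det_gram_pos[OF inj] by (simp add: invertible_det_nz)
  have GGi: "(transpose A ** A) *v (Gi *v y) = y" for y
    using inv by (simp add: Gi_def matrix_vector_mul_assoc matrix_inv_right)
  \<comment> \<open>Symmetry of \<open>Gi\<close> is read off from the Gram form at
    \<open>Gi *v h\<close> and \<open>Gi *v b\<close>, which the Gram matrix sends to
    \<open>h\<close> and \<open>b\<close>.\<close>
  have sym: "b \<bullet> (Gi *v h) = h \<bullet> (Gi *v b)" for h
    using gram_inner[of "Gi *v h" A "Gi *v b"] gram_inner[of "Gi *v b" A "Gi *v h"]
    by (simp add: GGi inner_commute)
  have "((\<lambda>y. 1/2 * (y \<bullet> (Gi *v y))) has_derivative (\<lambda>h. 1/2 * (b \<bullet> (Gi *v h) + h \<bullet> (Gi *v b)))) (at b)"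
    by (intro has_derivative_mult_right has_derivative_inner has_derivative_ident
        bounded_linear.has_derivative[OF matrix_vector_mul_bounded_linear])
  then show ?thesis by (simp add: gderiv_def sym)
qed

section \<open>Newtonian motion on \<open>M\<close> read in coordinates\<close>

theorem theorem2p6:
  fixes g :: "real ^ 'd \<Rightarrow> real ^ 'n"
    and M :: "(real ^ 'n) set"
    and \<pi> :: "real ^ 'd \<Rightarrow> real"
    and I :: "real set"
    and q p :: "real \<Rightarrow> real ^ 'n"
  assumes "submanifold TYPE('d) M"
    and "parametrization g M"
    and "\<And>x. (\<lambda>y. jacobian g (at y)) differentiable (at x)"
    and "prob_density \<pi>"
    and "is_interval I"
    and "\<And>t. t \<in> I \<Longrightarrow> \<pi> (inv g (q t)) > 0"
    and "\<And>t. t \<in> I \<Longrightarrow> \<pi> differentiable (at (inv g (q t)))"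
    and "newtonian_solution M (\<lambda>y. - ln (pushforward_density g \<pi> y)) I q p"
  shows "hamiltonian_solution (riemannian_hamiltonian g \<pi>) I
           (\<lambda>t. inv g (q t))
           (\<lambda>t. transpose (jacobian g (at (inv g (q t)))) *v p t)"
proof -
  define J where "J y = jacobian g (at y)" for y
  define G where "G y = transpose (J y) ** J y" for y
  have metric: "metric g = G" by (simp add: fun_eq_iff metric_def G_def J_def)
  have g: "bij_betw g UNIV M" and gdiff: "\<And>y. g differentiable (at y)"
    and rank: "\<And>y. rank (J y) = CARD('d)"
    using assms(2) by (simp_all add: parametrization_def J_def)
  have "inj g" and rng: "range g = M" using g by (auto simp: bij_betw_def)
  have dg: "(g has_derivative (\<lambda>h. J y *v h)) (at y)" for y
    using gdiff jacobian_works by (auto simp: J_def)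
  have injJ: "inj ((*v) (J y))" for y
    using rank by (simp add: full_rank_injective)
  have detG: "det (G y) > 0" for y
    unfolding G_def by (rule det_gram_pos[OF injJ])
  then have invG: "invertible (G y)" for y by (simp add: invertible_det_nz less_imp_neq[symmetric])
  have cont_inv: "continuous_on M (inv g)"
    by (rule continuous_on_inv_parametrization[OF assms(1,2)])
  \<comment> \<open>The momentum-free part of the Hamiltonian; where \<open>\<pi>\<close> is
    positive it is the potential on \<open>M\<close> pulled back by \<open>g\<close>.\<close>
  define F where "F x = - ln (\<pi> x) + ln (det (G x) powr (1/2))" for x
  show ?thesis
    unfolding hamiltonian_solution_def
  proof
    fix t assume t: "t \<in> I"
    define x where "x = inv g (q t)"
    have qM: "q t \<in> M" and pT: "p t \<in> tangent_space M (q t)"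
      and dq: "(q has_vector_derivative p t) (at t within I)"
      using assms(8) t by (auto simp: newtonian_solution_def)
    \<comment> \<open>\<open>a\<close> is the ambient acceleration and \<open>a + w\<close> the
      constraint force, orthogonal to the tangent space.\<close>
    obtain w a where w: "has_manifold_gradient M (\<lambda>y. - ln (pushforward_density g \<pi> y)) (q t) w"
      and a: "(p has_vector_derivative a) (at t within I)"
      and aw: "\<And>v. v \<in> tangent_space M (q t) \<Longrightarrow> (a - (- w)) \<bullet> v = 0"
      using assms(8) t unfolding newtonian_solution_def has_covariant_derivative_def by blast
    have gx: "g x = q t" using qM rng by (simp add: x_def f_inv_into_f)
    obtain B where B: "(J has_derivative B) (at x)"
      using assms(3)[of x] by (auto simp: J_def[abs_def] differentiable_def)
    have sym: "B h *v k = B k *v h" for h k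
      by (rule symmetric_jacobian_derivative[OF dg B])

    \<comment> \<open>Velocity of the lifted trajectory\<close>
    \<comment> \<open>The pseudoinverse of \<open>J x\<close>: a left inverse that vanishes on
      normal vectors.\<close>
    define L where "L v = matrix_inv (G x) *v (transpose (J x) *v v)" for v
    have L: "bounded_linear L"
      unfolding L_def by (intro bounded_linear_compose[OF matrix_vector_mul_bounded_linear] matrix_vector_mul_bounded_linear)
    have LJ: "L (J x *v h) = h" for h
      using matrix_inv_left[OF invG[of x]]
      by (simp add: L_def matrix_vector_mul_assoc G_def del: transpose_matrix_vector)
    define u where "u = L (p t)"
    have pt: "J x *v u = p t"
      unfolding u_def
      by (rule tangent_vector_inverse[of g]) (use cont_inv rng \<open>inj g\<close> dg L LJ pT gx in auto)
    have d\<theta>: "((\<lambda>s. inv g (q s)) has_vector_derivative u) (at t within I)"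
      unfolding u_def
    proof (rule has_vector_derivative_lift[OF _ L LJ])
      show "(g has_derivative (*v) (J x)) (at (inv g (q t)))"
        using dg[of x] by (simp add: x_def)
      have "q ` I \<subseteq> M" using assms(8) by (auto simp: newtonian_solution_def)
      moreover have "continuous (at t within I) q"
        using dq by (rule has_vector_derivative_continuous)
      ultimately show "continuous (at t within I) (\<lambda>s. inv g (q s))"
        using cont_inv qM continuous_within_subset[of "q t" M "inv g" "q ` I"]
        by (intro continuous_within_compose2[of t I q "inv g"]) (auto simp: continuous_on_eq_continuous_within)
      show "((\<lambda>s. g (inv g (q s))) has_vector_derivative p t) (at t within I)"
        using dq by (rule has_vector_derivative_transform[OF t, rotated])
          (use \<open>q ` I \<subseteq> M\<close> rng in \<open>auto simp: f_inv_into_f\<close>)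
    qed

    \<comment> \<open>Gradient of the potential in coordinates\<close>
    have "(\<lambda>y. det (G y)) differentiable (at x)"
      by (intro differentiable_det differentiable_vec_nth differentiableI[OF has_derivative_gram[OF B, folded G_def]])
    then obtain d' where d': "((\<lambda>y. det (G y)) has_derivative d') (at x)"
      by (auto simp: differentiable_def)
    have \<pi>x: "\<pi> x > 0" using assms(6)[OF t] by (simp add: x_def)
    have \<pi>diff: "\<pi> differentiable (at x)" using assms(7)[OF t] by (simp add: x_def)
    then obtain \<pi>' where \<pi>': "(\<pi> has_derivative \<pi>') (at x)" by (auto simp: differentiable_def)
    have F_eq: "F = (\<lambda>y. - ln (\<pi> y) + 1/2 * ln (det (G y)))"
      using detG by (simp add: F_def ln_powr fun_eq_iff)
    have "((\<lambda>y. ln (\<pi> y)) has_derivative (\<lambda>h. \<pi>' h * inverse (\<pi> x))) (at x)"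
      using has_derivative_ln[OF \<pi>x \<pi>'] .
    moreover have "((\<lambda>y. ln (det (G y))) has_derivative (\<lambda>h. d' h * inverse (det (G x)))) (at x)"
      using has_derivative_ln[OF detG d'] .
    ultimately have "F differentiable (at x)"
      unfolding F_eq by (intro differentiable_add differentiable_minus differentiable_mult differentiable_const differentiableI)
    then obtain D where D: "GDERIV F x :> D" by (rule GDERIV_exists)

    have U_eq: "- ln (pushforward_density g \<pi> (g y)) = F y" if "\<pi> y > 0" for y
      using that detG[of y] \<open>inj g\<close>
      by (simp add: pushforward_density_def metric F_eq ln_mult ln_powr)
    have wJ: "w \<bullet> (J x *v h) = h \<bullet> D" and JT: "J x *v h \<in> tangent_space M (q t)" for h
    proof -
      \<comment> \<open>Along this curve the potential is differentiated in two ways, through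
        \<open>w\<close> and through \<open>F\<close>; uniqueness equates the results.\<close>
      let ?c = "\<lambda>s. g (x + s *\<^sub>R h)"
      have c: "curve_on M ?c (q t)" "(?c has_vector_derivative J x *v h) (at 0)"
        using line_curve[OF gdiff dg[of x]] by (simp_all add: rng gx)
      then show "J x *v h \<in> tangent_space M (q t)" by (auto simp: tangent_space_def)
      have 1: "((\<lambda>s. - ln (pushforward_density g \<pi> (?c s))) has_real_derivative w \<bullet> (J x *v h)) (at 0)"
        using w c by (auto simp: has_manifold_gradient_def)
      have "((\<lambda>s. x + s *\<^sub>R h) has_derivative (\<lambda>s. s *\<^sub>R h)) (at 0)"
        by (auto intro!: derivative_eq_intros)
      moreover have "(F has_derivative (\<lambda>k. k \<bullet> D)) (at (x + 0 *\<^sub>R h))"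
        using D by (simp add: gderiv_def)
      ultimately have "((\<lambda>s. F (x + s *\<^sub>R h)) has_derivative (\<lambda>s. (s *\<^sub>R h) \<bullet> D)) (at 0)"
        by (rule has_derivative_compose)
      then have 2: "((\<lambda>s. F (x + s *\<^sub>R h)) has_real_derivative h \<bullet> D) (at 0)"
        by (simp add: has_field_derivative_def mult_commute_abs)
      have "isCont (\<lambda>s. \<pi> (x + s *\<^sub>R h)) 0"
        by (rule isCont_o2) (use differentiable_imp_continuous_within[OF \<pi>diff] in \<open>auto intro!: continuous_intros\<close>)
      then have "\<forall>\<^sub>F s in at 0. \<pi> (x + s *\<^sub>R h) > 0"
        using \<pi>x unfolding isCont_def by (intro order_tendstoD(1)) auto
      \<comment> \<open>The congruence rule for derivatives compares functions on a full
        neighbourhood, including \<open>s = 0\<close>, where positivity is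
        \<open>\<pi>x\<close>.\<close>
      then have "\<forall>\<^sub>F s in nhds 0. \<pi> (x + s *\<^sub>R h) > 0"
        using \<pi>x by (simp add: eventually_nhds_conv_at)
      then have "\<forall>\<^sub>F s in nhds 0. - ln (pushforward_density g \<pi> (?c s)) = F (x + s *\<^sub>R h)"
        by (rule eventually_mono) (rule U_eq)
      from DERIV_cong_ev[OF refl this refl] 1
      have "((\<lambda>s. F (x + s *\<^sub>R h)) has_real_derivative w \<bullet> (J x *v h)) (at 0)" by (rule iffD1)
      then show "w \<bullet> (J x *v h) = h \<bullet> D" using 2 by (rule DERIV_unique)
    qed
    \<comment> \<open>\<open>J x\<close> maps into the tangent space, so its transpose annihilates
      \<open>a + w\<close>, and \<open>wJ\<close> identifies the image of \<open>w\<close> with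
      \<open>D\<close>.\<close>
    have aD: "transpose (J x) *v a = - D"
    proof -
      have "h \<bullet> (transpose (J x) *v a) = h \<bullet> - D" for h
        using aw[OF JT[of h]] wJ[of h]
        by (simp add: inner_transpose_matrix_vector inner_add_left inner_commute[of a] inner_commute[of w]
            del: transpose_matrix_vector)
      then show ?thesis using vector_eq_ldot by blast
    qed

    \<comment> \<open>Partial gradients of the Hamiltonian and the equations of motion\<close>
    define b where "b = transpose (J x) *v p t"
    have u: "u = matrix_inv (G x) *v b" by (simp add: u_def L_def b_def)
    have Hq: "GDERIV (\<lambda>y. riemannian_hamiltonian g \<pi> y b) x :> D - transpose (B u) *v p t"
    proof -
      have "((\<lambda>y. F y + 1/2 * (b \<bullet> (matrix_inv (G y) *v b))) has_derivative
          (\<lambda>h. h \<bullet> D + - ((J x *v u) \<bullet> (B h *v u)))) (at x)"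
        unfolding u G_def
        by (intro has_derivative_add D[unfolded gderiv_def] has_derivative_kinetic_energy B injJ)
      \<comment> \<open>Symmetry replaces \<open>B h *v u\<close> by \<open>B u *v h\<close>, which
        turns the expression into an inner product with \<open>h\<close> and exhibits the
        gradient.\<close>
      moreover have "h \<bullet> D + - ((J x *v u) \<bullet> (B h *v u)) = h \<bullet> (D - transpose (B u) *v p t)" for h
        by (simp add: pt sym[of h u] inner_diff_right inner_transpose_matrix_vector inner_commute
            del: transpose_matrix_vector)
      ultimately show ?thesis
        by (simp add: gderiv_def riemannian_hamiltonian_def metric F_def)
    qed
    have "GDERIV (\<lambda>y. F x + 1/2 * (y \<bullet> (matrix_inv (G x) *v y))) b :> 0 + u"
      unfolding u G_def by (intro GDERIV_add GDERIV_const GDERIV_kinetic_energy injJ)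
    then have Hp: "GDERIV (\<lambda>y. riemannian_hamiltonian g \<pi> x y) b :> u"
      by (simp add: riemannian_hamiltonian_def metric F_def)
    have "(J has_derivative B) (at (inv g (q t)) within (\<lambda>s. inv g (q s)) ` I)"
      using has_derivative_at_withinI[OF B] by (simp add: x_def)
    from vector_derivative_diff_chain_within[OF d\<theta> this]
    have "((\<lambda>s. J (inv g (q s))) has_vector_derivative B u) (at t within I)"
      by (simp add: o_def)
    \<comment> \<open>Product rule for the momentum: the change of the Jacobian along the trajectory
      contributes \<open>transpose (B u) *v p t\<close>, exactly minus the position gradient of the
      kinetic energy.\<close>
    from bounded_bilinear.has_vector_derivative[OF bounded_bilinear_matrix_vector_mult
        bounded_linear.has_vector_derivative[OF bounded_linear_transpose this] a]
    have "((\<lambda>s. transpose (J (inv g (q s))) *v p s) has_vector_derivative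
        transpose (J x) *v a + transpose (B u) *v p t) (at t within I)"
      by (simp only: x_def)
    then have "((\<lambda>s. transpose (J (inv g (q s))) *v p s) has_vector_derivative
        - (D - transpose (B u) *v p t)) (at t within I)"
      by (simp only: aD minus_diff_eq uminus_add_conv_diff)
    then show "\<exists>Hq Hp.
        GDERIV (\<lambda>x. riemannian_hamiltonian g \<pi> x (transpose (jacobian g (at (inv g (q t)))) *v p t)) (inv g (q t)) :> Hq \<and>
        GDERIV (riemannian_hamiltonian g \<pi> (inv g (q t))) (transpose (jacobian g (at (inv g (q t)))) *v p t) :> Hp \<and>
        ((\<lambda>t. inv g (q t)) has_vector_derivative Hp) (at t within I) \<and>
        ((\<lambda>t. transpose (jacobian g (at (inv g (q t)))) *v p t) has_vector_derivative - Hq) (at t within I)"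
      using Hq Hp d\<theta> unfolding b_def x_def J_def by blast
  qed
qed

end
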